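(* Let $d\ge 1$ be an integer. Identify the points of ${\rm PG}(2d,4)$ with the nonzero elements of ${\mathbb F}_{4^{2d+1}}$ modulo ${\mathbb F}_4^*$ (so that $\langle x\rangle=\langle y\rangle$ iff $x/y\in{\mathbb F}_4$). Then the set $$\theta_0=\{\langle x\rangle \mid x\in{\mathbb F}_{4^{2d+1}},\ x^{2^{2d+1}+1}=1\}$$ is a complete $4$-general set of ${\rm PG}(2d,4)$ of size $\frac{2^{2d+1}+1}{3}$.
   Context: ${\mathbb F}_{4^{2d+1}}$ is viewed as a $(2d+1)$-dimensional ${\mathbb F}_4$-vector space, so its nonzero elements up to ${\mathbb F}_4^*$-multiples are the points of ${\rm PG}(2d,4)$. A $4$-general set of ${\rm PG}(n,q)$ is a set of points spanning ${\rm PG}(n,q)$ such that no four of its points lie on a plane; it is complete if it is not contained in a strictly larger $4$-general set. *)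

theory Defs
  imports Complex_Main "HOL-Library.Cardinality"
begin

text \<open>
  Projective geometry of the vector space with scalar multiplication \<open>s\<close>. Projective dimension is
  vector space dimension minus one, so points, respectively planes, are the linear subspaces of
  dimension 1, respectively 3, and incidence is inclusion.
\<close>

definition pg_points :: "('k::field \<Rightarrow> 'v::ab_group_add \<Rightarrow> 'v) \<Rightarrow> 'v set set" where
  "pg_points s = {P. module.subspace s P \<and> vector_space.dim s P = 1}"

definition pg_planes :: "('k::field \<Rightarrow> 'v::ab_group_add \<Rightarrow> 'v) \<Rightarrow> 'v set set" where
  "pg_planes s = {W. module.subspace s W \<and> vector_space.dim s W = 3}"

definition four_general :: "('k::field \<Rightarrow> 'v::ab_group_add \<Rightarrow> 'v) \<Rightarrow> 'v set set \<Rightarrow> bool" where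
  "four_general s S \<longleftrightarrow>
     S \<subseteq> pg_points s \<and>
     module.span s (\<Union>S) = UNIV \<and>
     (\<forall>T\<subseteq>S. card T = 4 \<longrightarrow> \<not> (\<exists>W\<in>pg_planes s. \<forall>P\<in>T. P \<subseteq> W))"

definition complete_four_general ::
    "('k::field \<Rightarrow> 'v::ab_group_add \<Rightarrow> 'v) \<Rightarrow> 'v set set \<Rightarrow> bool" where
  "complete_four_general s S \<longleftrightarrow>
     four_general s S \<and> \<not> (\<exists>S'. S \<subset> S' \<and> four_general s S')"

definition field_embedding :: "('k::field \<Rightarrow> 'l::field) \<Rightarrow> bool" where
  "field_embedding \<iota> \<longleftrightarrow>
     \<iota> 1 = 1 \<and> (\<forall>a b. \<iota> (a + b) = \<iota> a + \<iota> b) \<and> (\<forall>a b. \<iota> (a * b) = \<iota> a * \<iota> b)"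

definition ext_scale :: "('k::field \<Rightarrow> 'l::field) \<Rightarrow> 'k \<Rightarrow> 'l \<Rightarrow> 'l" where
  "ext_scale \<iota> c x = \<iota> c * x"

lemma vector_space_ext_scale:
  assumes "field_embedding \<iota>"
  shows "vector_space (ext_scale \<iota>)"
  using assms by unfold_locales (auto simp: field_embedding_def ext_scale_def algebra_simps)

definition ext_point :: "('k::field \<Rightarrow> 'l::field) \<Rightarrow> 'l \<Rightarrow> 'l set" where
  "ext_point \<iota> x = module.span (ext_scale \<iota>) {x}"

lemma ext_point_in_pg_points:
  assumes "field_embedding \<iota>" and "x \<noteq> 0"
  shows "ext_point \<iota> x \<in> pg_points (ext_scale \<iota>)"
proof -
  interpret vector_space "ext_scale \<iota>"
    using assms(1) by (rule vector_space_ext_scale)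
  show ?thesis
    using assms(2) dim_span_eq_card_independent[of "{x}"]
    by (simp add: pg_points_def ext_point_def)
qed

lemma ext_point_eq_iff:
  assumes "field_embedding \<iota>" and "x \<noteq> 0" and "y \<noteq> 0"
  shows "ext_point \<iota> x = ext_point \<iota> y \<longleftrightarrow> x / y \<in> range \<iota>"
proof -
  interpret vector_space "ext_scale \<iota>"
    using assms(1) by (rule vector_space_ext_scale)
  have sp: "ext_point \<iota> z = range (\<lambda>c. \<iota> c * z)" for z
    by (simp add: ext_point_def span_singleton ext_scale_def)
  show ?thesis
  proof
    assume eq: "ext_point \<iota> x = ext_point \<iota> y"
    have "x \<in> ext_point \<iota> x"
      by (simp add: ext_point_def span_base)
    then obtain c where "x = \<iota> c * y"
      using eq sp by auto
    then show "x / y \<in> range \<iota>"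
      using assms(3) by simp
  next
    assume "x / y \<in> range \<iota>"
    then obtain c where "x / y = \<iota> c" by auto
    then have x: "x = ext_scale \<iota> c y"
      using assms(3) by (simp add: ext_scale_def field_simps)
    then have "c \<noteq> 0"
      using assms(2) by auto
    then have "y = ext_scale \<iota> (inverse c) x"
      using x by simp
    with x show "ext_point \<iota> x = ext_point \<iota> y"
      unfolding ext_point_def
      by (intro equalityI span_minimal subspace_span)
         (metis empty_subsetI insert_subset singletonI span_base span_scale)+
  qed
qed

definition theta0 :: "('k::field \<Rightarrow> 'l::field) \<Rightarrow> nat \<Rightarrow> 'l set set" where
  "theta0 \<iota> d = {ext_point \<iota> x | x. x ^ (2 ^ (2 * d + 1) + 1) = 1}"

end

(* Put q = 2^(2d+1) and U = {x. x^(q+1) = 1}. As 3 divides q+1, U contains the nonzero scalars, so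
   linear relations between points of theta0 are sums of elements of U. Conjugation x -> x^q inverts
   U, so a + b = c + e in U gives a + b = 0 or ab = ce, and every such relation is trivial: no four
   points are coplanar. Conversely every nonzero element lies in U or is a sum of three elements of
   U, so theta0 spans and every other point is on a plane with three points of theta0. *)
theory Submission
  imports Defs "HOL-Computational_Algebra.Polynomial"
begin

section \<open>Counting in finite fields\<close>

lemma finite_field_power_card_minus_1:
  fixes x :: "'a::{field,finite}"
  assumes "x \<noteq> 0"
  shows "x ^ (CARD('a) - 1) = 1"
proof -
  let ?N = "UNIV - {0::'a}"
  have "bij_betw ((*) x) ?N ?N"
    by (rule bij_betw_byWitness[where f' = "\<lambda>y. y / x"]) (use assms in auto)
  then have "(\<Prod>y\<in>?N. x * y) = \<Prod>?N"
    by (rule prod.reindex_bij_betw)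
  \<comment> \<open>Multiplication by \<open>x\<close> permutes the nonzero elements and so
    preserves their product, which can then be cancelled.\<close>
  then have "x ^ card ?N * \<Prod>?N = 1 * \<Prod>?N"
    by (simp add: prod.distrib)
  moreover have "\<Prod>?N \<noteq> 0"
    by simp
  ultimately show ?thesis
    by (simp add: card_Diff_singleton)
qed

text \<open>Translation by 1 permutes the field, so adding 1 to every summand leaves the sum of all
  elements unchanged. This is the source of characteristic two below.\<close>

lemma of_nat_card_eq_0: "of_nat CARD('a) = (0::'a::{field,finite})"
proof -
  have "bij_betw (\<lambda>x::'a. x + 1) UNIV UNIV"
    by (rule bij_betw_byWitness[where f' = "\<lambda>y. y - 1"]) auto
  then have "(\<Sum>x::'a\<in>UNIV. x + 1) = \<Sum>UNIV"
    by (rule sum.reindex_bij_betw)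
  then show ?thesis
    by (simp add: sum.distrib)
qed

text \<open>The elements counted are the roots of \<open>X ^ n - c\<close>, which for
  \<open>n > 0\<close> has leading coefficient 1 and hence is nonzero.\<close>

lemma card_power_eq_le:
  fixes c :: "'a::field"
  assumes "n > 0"
  shows "card {x. x ^ n = c} \<le> n"
proof -
  define p where "p = monom 1 n - [:c:]"
  have deg: "degree p \<le> n"
    unfolding p_def by (intro degree_diff_le) (simp_all add: degree_monom_eq)
  have "coeff p n = 1"
    using assms by (simp add: p_def coeff_pCons split: nat.split)
  then have "p \<noteq> 0"
    by auto
  have "card {x. x ^ n = c} = card {x. poly p x = 0}"
    by (simp add: p_def poly_monom)
  also have "\<dots> \<le> degree p"
    using \<open>p \<noteq> 0\<close> by (rule card_poly_roots_bound)
  finally show ?thesis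
    using deg by simp
qed

text \<open>Besides 0 there are only the roots of unity of order dividing \<open>n - 1\<close>. With
  \<open>n = q\<close> this bounds the subfield fixed by conjugation.\<close>

lemma card_power_fixed_le:
  assumes "n > 1"
  shows "card {x::'a::{field,finite}. x ^ n = x} \<le> n"
proof -
  have "{x::'a. x ^ n = x} \<subseteq> insert 0 {x. x ^ (n - 1) = 1}"
    using assms by (auto simp: power_eq_if[of _ n])
  then have "card {x::'a. x ^ n = x} \<le> card (insert 0 {x::'a. x ^ (n - 1) = 1})"
    by (intro card_mono) auto
  also have "\<dots> \<le> Suc (card {x::'a. x ^ (n - 1) = 1})"
    by (rule card_insert_le_m1) auto
  also have "\<dots> \<le> n"
    using card_power_eq_le[of "n - 1" "1::'a"] assms by linarith
  finally show ?thesis .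
qed

text \<open>Serves to bound images from below: that of \<open>x ^ (q - 1)\<close> on the nonzero
  elements, and that of the trace \<open>u + inverse u\<close> on \<open>U\<close>.\<close>

lemma card_le_fibres:
  assumes "finite A" and "\<And>y. y \<in> f ` A \<Longrightarrow> card {x \<in> A. f x = y} \<le> k"
  shows "card A \<le> k * card (f ` A)"
proof -
  have "A = (\<Union>y\<in>f ` A. {x \<in> A. f x = y})"
    by auto
  then have "card A \<le> (\<Sum>y\<in>f ` A. card {x \<in> A. f x = y})"
    using card_UN_le[of "f ` A" "\<lambda>y. {x \<in> A. f x = y}"] assms(1) by simp
  also have "\<dots> \<le> of_nat (card (f ` A)) * k"
    by (rule sum_bounded_above) (rule assms(2))
  finally show ?thesis
    by (simp add: mult.commute)
qed

section \<open>Conjugation and the group of elements of norm 1\<close>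

locale quadratic_even_extension =
  fixes d :: nat and \<iota> :: "'k::{field,finite} \<Rightarrow> 'l::{field,finite}"
  assumes d_pos: "d \<ge> 1"
    and card_k: "CARD('k) = 4"
    and card_l: "CARD('l) = 4 ^ (2 * d + 1)"
    and emb: "field_embedding \<iota>"
begin

sublocale vector_space "ext_scale \<iota>"
  using emb by (rule vector_space_ext_scale)

definition q :: nat where "q = 2 ^ (2 * d + 1)"

text \<open>Since \<open>x ^ (q + 1) = x * x ^ q\<close>, these are the elements of norm 1 over the
  subfield of order \<open>q\<close>.\<close>

definition U :: "'l set" where "U = {x. x ^ (q + 1) = 1}"

lemma q_gt_1: "q > 1"
  unfolding q_def by (rule one_less_power) simp_all

lemma card_l_q: "CARD('l) = q * q"
  by (simp add: card_l q_def flip: power_mult_distrib)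

lemma char_two: "x + x = (0::'l)"
proof -
  \<comment> \<open>The order of the field vanishes in the field, and it is a power of
    \<open>2 * 2\<close>; a field has no nonzero nilpotents.\<close>
  have "(2 * 2::'l) ^ (2 * d + 1) = 0"
    using of_nat_card_eq_0[where 'a = 'l] by (simp add: card_l)
  then have "(2::'l) = 0"
    unfolding power_eq_0_iff mult_eq_0_iff by blast
  then show ?thesis
    by (metis mult_2 mult_zero_left)
qed

lemma uminus_eq: "- x = (x::'l)"
  using char_two minus_unique by blast

lemma add_eq_0_iff: "x + y = 0 \<longleftrightarrow> x = (y::'l)"
  by (metis add_eq_0_iff uminus_eq)

lemma square_add: "(x + y)\<^sup>2 = x\<^sup>2 + (y::'l)\<^sup>2"
proof -
  have "(x + y)\<^sup>2 = x\<^sup>2 + y\<^sup>2 + (x * y + x * y)"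
    by (simp add: power2_eq_square algebra_simps)
  then show ?thesis
    by (simp only: char_two add_0_right)
qed

text \<open>As \<open>q\<close> is a power of two, conjugation is an iterate of squaring, which is
  additive in characteristic two.\<close>

lemma power_q_add: "(x + y) ^ q = x ^ q + (y::'l) ^ q"
proof -
  have "(x + y) ^ 2 ^ n = x ^ 2 ^ n + (y::'l) ^ 2 ^ n" for n
    by (induction n) (simp_all add: power_mult square_add mult.commute[of 2])
  then show ?thesis
    unfolding q_def by blast
qed

lemma power_q_q: "x ^ (q * q) = (x::'l)"
proof (cases "x = 0")
  case False
  have "x ^ (q * q) = x * x ^ (CARD('l) - 1)"
    using q_gt_1 by (simp add: card_l_q flip: power_Suc)
  then show ?thesis
    using finite_field_power_card_minus_1[OF False] by simp
qed (use q_gt_1 in auto)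

lemma U_nonzero: "u \<in> U \<Longrightarrow> u \<noteq> 0"
  by (auto simp: U_def)

lemma power_q_U: "u \<in> U \<Longrightarrow> u ^ q = inverse u"
  using U_nonzero[of u] by (simp add: U_def field_simps)

lemma one_U: "1 \<in> U"
  by (simp add: U_def)

lemma mult_U: "u \<in> U \<Longrightarrow> v \<in> U \<Longrightarrow> u * v \<in> U"
  unfolding U_def mem_Collect_eq power_mult_distrib by simp

lemma inverse_U: "u \<in> U \<Longrightarrow> inverse u \<in> U"
  unfolding U_def mem_Collect_eq power_inverse by simp

lemma power_U: "u \<in> U \<Longrightarrow> u ^ n \<in> U"
  by (induction n) (auto intro: one_U mult_U)

text \<open>The upper bound counts roots of a polynomial. For the lower one,
  \<open>x ^ (q - 1)\<close> maps the \<open>q * q - 1\<close> nonzero elements into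
  \<open>U\<close> with fibres of size at most \<open>q - 1\<close>.\<close>

lemma card_U: "card U = q + 1"
proof (rule antisym)
  show "card U \<le> q + 1"
    unfolding U_def by (rule card_power_eq_le) simp
  let ?N = "UNIV - {0::'l}"
  have "(\<lambda>x. x ^ (q - 1)) ` ?N \<subseteq> U"
  proof (rule image_subsetI)
    fix x :: 'l assume "x \<in> ?N"
    then have "x \<noteq> 0"
      by simp
    have "(q - 1) * (q + 1) = CARD('l) - 1"
      by (simp add: card_l_q algebra_simps)
    then show "x ^ (q - 1) \<in> U"
      using finite_field_power_card_minus_1[OF \<open>x \<noteq> 0\<close>]
      unfolding U_def by (simp only: mem_Collect_eq flip: power_mult)
  qed
  then have image: "card ((\<lambda>x. x ^ (q - 1)) ` ?N) \<le> card U"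
    by (intro card_mono) auto
  have "card ?N \<le> (q - 1) * card ((\<lambda>x. x ^ (q - 1)) ` ?N)"
  proof (rule card_le_fibres)
    fix y :: 'l
    have "card {x \<in> ?N. x ^ (q - 1) = y} \<le> card {x. x ^ (q - 1) = y}"
      by (intro card_mono) auto
    also have "\<dots> \<le> q - 1"
      using q_gt_1 by (intro card_power_eq_le) simp
    finally show "card {x \<in> ?N. x ^ (q - 1) = y} \<le> q - 1" .
  qed simp
  also have "\<dots> \<le> (q - 1) * card U"
    using image by simp
  finally have "q * q - 1 \<le> (q - 1) * card U"
    by (simp add: card_l_q card_Diff_singleton)
  moreover have "(q - 1) * (q + 1) = q * q - 1"
    by (simp add: algebra_simps)
  ultimately have "(q - 1) * (q + 1) \<le> (q - 1) * card U"
    by simp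
  then show "q + 1 \<le> card U"
    using q_gt_1 by (simp only: mult_le_cancel1)
qed

section \<open>Relations between four elements of norm 1\<close>

lemma four_term_relation:
  assumes U: "a \<in> U" "b \<in> U" "c \<in> U" "e \<in> U" and sum: "a + b + c + e = 0"
  shows "a = b \<or> a = c \<or> a = e"
proof -
  have ce: "c + e = a + b"
    using sum add_eq_0_iff[of "a + b" "c + e"] by (simp add: add.assoc)
  \<comment> \<open>Conjugating the relation inverts each of its terms.\<close>
  have "inverse a + inverse b = inverse c + inverse e"
    using arg_cong[OF ce, of "\<lambda>x. x ^ q"] U by (simp add: power_q_add power_q_U)
  then have "(a + b) * (c * e) = (c + e) * (a * b)"
    using U[THEN U_nonzero] by (simp add: field_simps)
  then have "a + b = 0 \<or> c * e = a * b"
    by (simp add: ce)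
  then show ?thesis
  proof
    assume prod: "c * e = a * b"
    have e: "e = a + b - c"
      using ce by (simp add: algebra_simps)
    \<comment> \<open>The pairs \<open>a\<close>, \<open>b\<close> and \<open>c\<close>,
      \<open>e\<close> have equal sum and product, so they are the roots of the same
      quadratic.\<close>
    have "(c - a) * (c - b) = 0"
      using prod unfolding e by (simp add: algebra_simps)
    then show ?thesis
      using e by auto
  qed (simp add: add_eq_0_iff)
qed

section \<open>Sums of three elements of norm 1\<close>

lemma polar_decomposition:
  assumes "x \<noteq> 0"
  obtains r s where "x = r * s" "r ^ q = r" "s \<in> U"
proof
  \<comment> \<open>\<open>r\<close> is the square root of the norm of \<open>x\<close>: the norm is
    fixed by the power \<open>q\<close>, so the power \<open>q / 2\<close> extracts its
    root.\<close>
  define r where "r = (x ^ (q + 1)) ^ 2 ^ (2 * d)"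
  have conj: "(x ^ (q + 1)) ^ q = x ^ (q + 1)"
    using power_q_q[of x] by (simp add: power_mult_distrib flip: power_mult)
  then show r: "r ^ q = r"
    unfolding r_def by (metis mult.commute power_mult)
  have "r\<^sup>2 = (x ^ (q + 1)) ^ q"
    by (simp add: r_def q_def mult.commute flip: power_mult)
  then have "r\<^sup>2 = x ^ (q + 1)"
    using conj by simp
  moreover have "r \<noteq> 0"
    using assms by (simp add: r_def)
  ultimately show "x / r \<in> U" "x = r * (x / r)"
    using r assms by (simp_all add: U_def power_divide power2_eq_square)
qed

text \<open>
  With \<open>x = r * s\<close> in polar form, the traces \<open>u + 1/u\<close> of elements of \<^term>\<open>U\<close> fill more than half
  of the subfield of order \<open>q\<close>, so they meet their image under
  \<open>t \<mapsto> r\<^sup>2 + 1 + r t\<close>. As \<open>r\<^sup>2 + 1 + r (u + 1/u)\<close> is the norm of \<open>r + u\<close>, this makes the norm of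
  some \<open>r + u\<close> a trace, which exhibits \<open>r + u\<close> as a sum of two elements of \<open>U\<close>.
\<close>
lemma three_term_representation:
  assumes "x \<noteq> 0"
  shows "x \<in> U \<or> (\<exists>a\<in>U. \<exists>b\<in>U. \<exists>c\<in>U. x = a + b + c)"
proof -
  obtain r s where x: "x = r * s" and r: "r ^ q = r" and s: "s \<in> U"
    using polar_decomposition[OF assms] .
  have "r \<noteq> 0"
    using assms x by auto
  define F where "F = {x::'l. x ^ q = x}"
  define T where "T = (\<lambda>u. u + inverse u) ` U"
  define \<phi> where "\<phi> = (\<lambda>t. r\<^sup>2 + 1 + r * t)"
  have trace_fixed: "(u + inverse u) ^ q = u + inverse u" if "u \<in> U" for u
    using that by (simp add: power_q_add power_q_U inverse_U)
  have "T \<subseteq> F"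
    by (auto simp: T_def F_def trace_fixed)
  moreover have "\<phi> ` F \<subseteq> F"
  proof safe
    fix t assume "t \<in> F"
    moreover have "(r\<^sup>2) ^ q = r\<^sup>2"
      by (metis r power_mult mult.commute)
    ultimately show "\<phi> t \<in> F"
      by (simp add: \<phi>_def F_def power_q_add power_mult_distrib r)
  qed
  ultimately have sub: "T \<union> \<phi> ` T \<subseteq> F"
    by auto
  have "card U \<le> 2 * card T"
    unfolding T_def
  proof (rule card_le_fibres)
    fix y assume "y \<in> (\<lambda>u. u + inverse u) ` U"
    then obtain v where v: "v \<in> U" "y = v + inverse v"
      by auto
    \<comment> \<open>Here \<open>u\<close> and \<open>v\<close> have the same trace, so
      \<open>u\<close> is a root of the quadratic with roots \<open>v\<close> and
      \<open>inverse v\<close>.\<close>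
    have "u = v \<or> u = inverse v" if u: "u \<in> U" "u + inverse u = y" for u
    proof -
      have "(u - v) * (u - inverse v) = u * (u + inverse u - (v + inverse v))"
        using u(1) v(1)[THEN U_nonzero] U_nonzero[of u] by (simp add: field_simps)
      then show ?thesis
        using u(2) v(2) by auto
    qed
    then have "{u \<in> U. u + inverse u = y} \<subseteq> {v, inverse v}"
      by auto
    then have "card {u \<in> U. u + inverse u = y} \<le> card {v, inverse v}"
      by (intro card_mono) auto
    also have "\<dots> \<le> 2"
      by (simp add: card_insert_if)
    finally show "card {u \<in> U. u + inverse u = y} \<le> 2" .
  qed simp
  moreover have "card (\<phi> ` T) = card T"
    by (rule card_image) (use \<open>r \<noteq> 0\<close> in \<open>auto simp: inj_on_def \<phi>_def\<close>)
  moreover have "card (T \<union> \<phi> ` T) \<le> q"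
    using card_mono[OF _ sub] card_power_fixed_le[OF q_gt_1, where 'a = 'l]
    by (simp add: F_def)
  ultimately have "T \<inter> \<phi> ` T \<noteq> {}"
    using card_U card_Un_disjoint[of T "\<phi> ` T"] by auto
  then obtain u v where u: "u \<in> U" and v: "v \<in> U"
    and uv: "v + inverse v = r\<^sup>2 + 1 + r * (u + inverse u)"
    by (auto simp: T_def \<phi>_def)
  \<comment> \<open>A square root of \<open>v\<close> inside \<open>U\<close>: the exponent is
    \<open>(q + 2) / 2\<close>, and \<open>v ^ (q + 2) = v\<close> because \<open>v\<close> has norm
    1.\<close>
  define w where "w = v ^ (2 ^ (2 * d) + 1)"
  have w: "w \<in> U"
    unfolding w_def using v by (rule power_U)
  have "w\<^sup>2 = v ^ (q + 1) * v"
    by (simp add: w_def q_def algebra_simps flip: power_mult power_add power_Suc power_Suc2)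
  then have "w\<^sup>2 = v"
    using v by (simp add: U_def)
  define t where "t = w + inverse w"
  have "t\<^sup>2 = v + inverse v"
    using \<open>w\<^sup>2 = v\<close> by (simp add: t_def square_add power_inverse)
  also have "\<dots> = (r + u) * (r + inverse u)"
    using U_nonzero[OF u] by (simp add: uv power2_eq_square algebra_simps)
  also have "\<dots> = (r + u) ^ (q + 1)"
    using u by (simp add: power_q_add power_q_U r)
  finally have norm: "(r + u) ^ (q + 1) = t\<^sup>2"
    by simp
  show ?thesis
  proof (cases "t = 0")
    case True
    with norm have "(r + u) ^ (q + 1) = 0"
      by simp
    then have "r = u"
      unfolding power_eq_0_iff add_eq_0_iff by blast
    then show ?thesis
      using x u s mult_U by simp
  next
    case False
    \<comment> \<open>Both \<open>r + u\<close> and \<open>t\<close> have norm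
      \<open>t\<^sup>2\<close>, the latter because the trace \<open>t\<close> is fixed by
      conjugation; so their quotient has norm 1. Now \<open>r + u = t * y\<close> splits along
      \<open>t = w + inverse w\<close>.\<close>
    define y where "y = (r + u) / t"
    have "t ^ (q + 1) = t\<^sup>2"
      using trace_fixed[OF w] by (simp add: t_def power2_eq_square)
    then have y: "y \<in> U"
      using norm False by (simp add: U_def y_def power_divide del: power_Suc)
    have "u + w * y + inverse w * y = u + t * y"
      by (simp add: t_def algebra_simps)
    also have "\<dots> = (u + u) + r"
      using False by (simp add: y_def)
    finally have "r = u + w * y + inverse w * y"
      by (simp add: char_two)
    then have "x = u * s + w * y * s + inverse w * y * s"
      by (simp add: x algebra_simps)
    then show ?thesis
      using u s w y by (blast intro: mult_U inverse_U)
  qed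
qed

section \<open>Scalars and points\<close>

lemma scalar_eq_0_iff [simp]: "\<iota> c = 0 \<longleftrightarrow> c = 0"
  using scale_eq_0_iff[of c 1] by (simp add: ext_scale_def)

lemma scalar_0 [simp]: "\<iota> 0 = 0"
  by simp

lemma power_scalar: "\<iota> (c ^ n) = \<iota> c ^ n"
  using emb by (induction n) (simp_all add: field_embedding_def)

text \<open>Nonzero scalars are cube roots of unity, and 3 divides \<open>q + 1\<close> because
  \<open>q\<close> is an odd power of 2. Coefficients of linear combinations can thus be absorbed
  into \<open>U\<close>.\<close>

lemma scalar_U:
  assumes "c \<noteq> 0"
  shows "\<iota> c \<in> U"
proof -
  have "3 dvd (2::nat) ^ (2 * n + 1) + 1" for n
  proof (induction n)
    case (Suc n)
    have "(2::nat) ^ (2 * Suc n + 1) + 1 = 3 * 2 ^ (2 * n + 1) + (2 ^ (2 * n + 1) + 1)"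
      by simp
    then show ?case
      using Suc by (metis dvd_add dvd_triv_left)
  qed simp
  then have "3 dvd q + 1"
    by (simp only: q_def)
  then obtain m where "q + 1 = 3 * m" ..
  moreover have "c ^ 3 = 1"
    using finite_field_power_card_minus_1[OF assms] by (simp add: card_k)
  ultimately have "c ^ (q + 1) = 1"
    by (simp add: power_mult del: power_Suc)
  then have "\<iota> c ^ (q + 1) = 1"
    using emb power_scalar[of c "q + 1"] by (simp add: field_embedding_def)
  then show ?thesis
    by (simp add: U_def)
qed

lemma ext_point_iff: "x \<in> ext_point \<iota> y \<longleftrightarrow> (\<exists>c. x = \<iota> c * y)"
  by (auto simp: ext_point_def span_singleton ext_scale_def)

lemma ext_point_scale:
  assumes "c \<noteq> 0" and "u \<noteq> 0"
  shows "ext_point \<iota> (\<iota> c * u) = ext_point \<iota> u"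
  using assms by (subst ext_point_eq_iff[OF emb]) auto

lemma theta0_eq: "theta0 \<iota> d = ext_point \<iota> ` U"
  by (auto simp: theta0_def U_def q_def)

section \<open>Linear independence of representatives of distinct points\<close>

lemma three_term_relation:
  assumes U: "a \<in> U" "b \<in> U" "c \<in> U" and sum: "a = b + c"
  shows "ext_point \<iota> a = ext_point \<iota> c"
proof -
  have "UNIV \<noteq> {0, 1::'k}"
    using card_k by (auto simp: card_insert_if dest: arg_cong[of _ _ card])
  \<comment> \<open>For a primitive cube root of unity \<open>w\<close>, the identity
    \<open>1 + w + w ^ 2 = 0\<close> replaces \<open>c\<close> by
    \<open>\<iota> w * c + \<iota> (w ^ 2) * c\<close>, which turns the relation into one with four
    terms in \<open>U\<close>.\<close>
  then obtain w :: 'k where w: "w \<noteq> 0" "w \<noteq> 1"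
    by auto
  have "w ^ 3 = 1"
    using finite_field_power_card_minus_1[OF w(1)] by (simp add: card_k)
  then have "(w - 1) * (1 + w + w ^ 2) = 0"
    by (simp add: algebra_simps power2_eq_square power3_eq_cube)
  then have "1 + w + w ^ 2 = 0"
    using w by simp
  then have "\<iota> (1 + w + w ^ 2) = 0"
    by simp
  then have "1 + \<iota> w + \<iota> (w ^ 2) = 0"
    using emb by (simp only: field_embedding_def)
  then have "(1 + \<iota> w + \<iota> (w ^ 2)) * c = 0"
    by simp
  moreover have "a + b + c = 0"
    using char_two[of a] by (simp add: sum add.assoc)
  ultimately have "a + b + c + c + \<iota> w * c + \<iota> (w ^ 2) * c = 0"
    by (simp add: algebra_simps)
  then have "a + b + \<iota> w * c + \<iota> (w ^ 2) * c = 0"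
    using char_two[of c] by (simp add: add.assoc)
  then have "a = b \<or> a = \<iota> w * c \<or> a = \<iota> (w ^ 2) * c"
    using U w by (intro four_term_relation mult_U scalar_U) auto
  moreover have "a \<noteq> b"
    using U_nonzero[OF U(3)] sum by auto
  ultimately show ?thesis
    using ext_point_scale[of w c] ext_point_scale[of "w ^ 2" c] w U_nonzero[OF U(3)] by auto
qed

lemma notin_span1:
  assumes "a \<in> U" "b \<in> U" "ext_point \<iota> a \<noteq> ext_point \<iota> b"
  shows "a \<notin> span {b}"
proof
  assume "a \<in> span {b}"
  then obtain k where k: "a = \<iota> k * b"
    by (auto simp: span_singleton ext_scale_def)
  then have "k \<noteq> 0"
    using U_nonzero[OF assms(1)] k by auto
  then show False
    using assms ext_point_scale[of k b] k U_nonzero by auto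
qed

text \<open>A vanishing coefficient would put \<open>a\<close> in the span of a single vector.
  Otherwise both coefficients are absorbed into \<open>U\<close>, and
  \<open>three_term_relation\<close> identifies the points of \<open>a\<close> and
  \<open>c\<close>.\<close>

lemma notin_span2:
  assumes "a \<in> U" "b \<in> U" "c \<in> U"
    and "ext_point \<iota> a \<noteq> ext_point \<iota> b" "ext_point \<iota> a \<noteq> ext_point \<iota> c"
  shows "a \<notin> span {b, c}"
proof
  assume a: "a \<in> span {b, c}"
  then obtain k l where kl: "a = \<iota> k * b + \<iota> l * c"
    by (auto simp: span_insert[of b] span_singleton ext_scale_def algebra_simps)
  have "k \<noteq> 0"
    using kl assms notin_span1[of a c]
    by (auto simp: span_singleton ext_scale_def)
  moreover have "l \<noteq> 0"
    using kl assms notin_span1[of a b]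
    by (auto simp: span_singleton ext_scale_def)
  ultimately have "ext_point \<iota> a = ext_point \<iota> (\<iota> l * c)"
    using kl assms by (intro three_term_relation) (auto intro: mult_U scalar_U)
  then show False
    using \<open>l \<noteq> 0\<close> assms U_nonzero ext_point_scale by auto
qed

text \<open>A vanishing coefficient reduces to \<open>notin_span2\<close>; with all three nonzero,
  \<open>four_term_relation\<close> makes \<open>a\<close> a scalar multiple of \<open>b\<close>,
  \<open>c\<close> or \<open>e\<close>.\<close>

lemma notin_span3:
  assumes "a \<in> U" "b \<in> U" "c \<in> U" "e \<in> U"
    and "ext_point \<iota> a \<noteq> ext_point \<iota> b" "ext_point \<iota> a \<noteq> ext_point \<iota> c"
    and "ext_point \<iota> a \<noteq> ext_point \<iota> e"
  shows "a \<notin> span {b, c, e}"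
proof
  assume a: "a \<in> span {b, c, e}"
  then obtain k l m where klm: "a = \<iota> k * b + \<iota> l * c + \<iota> m * e"
    by (auto simp: span_insert[of b] span_insert[of c] span_singleton ext_scale_def algebra_simps)
  have scale: "\<iota> j * x + \<iota> i * y \<in> span {x, y}" for i j x y
    using span_add[OF span_scale[OF span_base] span_scale[OF span_base]]
    by (metis ext_scale_def insertI1 insertI2)
  have "k \<noteq> 0"
    using klm assms notin_span2[of a c e] scale[of l c m e] by auto
  moreover have "l \<noteq> 0"
    using klm assms notin_span2[of a b e] scale[of k b m e] by auto
  moreover have "m \<noteq> 0"
    using klm assms notin_span2[of a b c] scale[of k b l c] by auto
  moreover have "a + \<iota> k * b + \<iota> l * c + \<iota> m * e = 0"
    using char_two[of a] by (simp add: klm add_ac)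
  ultimately have "a = \<iota> k * b \<or> a = \<iota> l * c \<or> a = \<iota> m * e"
    using assms by (intro four_term_relation) (auto intro: mult_U scalar_U)
  then show False
    using \<open>k \<noteq> 0\<close> \<open>l \<noteq> 0\<close> \<open>m \<noteq> 0\<close> assms U_nonzero ext_point_scale by metis
qed

lemma independent3:
  assumes "a \<in> U" "b \<in> U" "c \<in> U"
    and "ext_point \<iota> a \<noteq> ext_point \<iota> b" "ext_point \<iota> a \<noteq> ext_point \<iota> c"
    and "ext_point \<iota> b \<noteq> ext_point \<iota> c"
  shows "independent {a, b, c}"
  using assms U_nonzero[of c]
  by (intro independent_insertI notin_span2 notin_span1 independent_empty) simp_all

lemma independent4:
  assumes "a \<in> U" "b \<in> U" "c \<in> U" "e \<in> U"
    and "ext_point \<iota> a \<noteq> ext_point \<iota> b" "ext_point \<iota> a \<noteq> ext_point \<iota> c"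
    and "ext_point \<iota> a \<noteq> ext_point \<iota> e" "ext_point \<iota> b \<noteq> ext_point \<iota> c"
    and "ext_point \<iota> b \<noteq> ext_point \<iota> e" "ext_point \<iota> c \<noteq> ext_point \<iota> e"
  shows "independent {a, b, c, e}"
  using assms
  by (intro independent_insertI[of a] independent3 notin_span3) auto

section \<open>Spanning, and no four coplanar points\<close>

lemma mem_ext_point: "x \<in> ext_point \<iota> x"
  by (simp add: ext_point_def span_base)

lemma theta0_subset: "theta0 \<iota> d \<subseteq> pg_points (ext_scale \<iota>)"
  using U_nonzero ext_point_in_pg_points[OF emb] by (auto simp: theta0_eq)

lemma span_theta0: "span (\<Union>(theta0 \<iota> d)) = UNIV"
proof -
  have U: "u \<in> span (\<Union>(theta0 \<iota> d))" if "u \<in> U" for u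
    using that mem_ext_point by (intro span_base) (auto simp: theta0_eq)
  have "x \<in> span (\<Union>(theta0 \<iota> d))" for x
  proof (cases "x = 0 \<or> x \<in> U")
    case False
    then obtain a b c where "a \<in> U" "b \<in> U" "c \<in> U" "x = a + b + c"
      using three_term_representation[of x] by auto
    then show ?thesis
      using U by (simp add: span_add)
  qed (use U span_zero in auto)
  then show ?thesis
    by auto
qed

lemma four_general_theta0: "four_general (ext_scale \<iota>) (theta0 \<iota> d)"
  unfolding four_general_def
proof (intro conjI allI impI notI theta0_subset span_theta0)
  fix T
  assume T: "T \<subseteq> theta0 \<iota> d" "card T = 4"
    and "\<exists>W\<in>pg_planes (ext_scale \<iota>). \<forall>P\<in>T. P \<subseteq> W"
  then obtain W where W: "dim W = 3" "\<And>P. P \<in> T \<Longrightarrow> P \<subseteq> W"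
    by (auto simp: pg_planes_def)
  \<comment> \<open>One representative in \<open>U\<close> per point; four independent vectors will
    not fit into a subspace of dimension 3.\<close>
  obtain X where X: "X \<subseteq> U" "T = ext_point \<iota> ` X" "inj_on (ext_point \<iota>) X"
    using T(1) subset_image_inj[of T "ext_point \<iota>" U] by (auto simp: theta0_eq)
  have "card X = 4"
    using T(2) X by (simp add: card_image)
  then obtain a Y where "X = insert a Y" "a \<notin> Y" "card Y = 3"
    using card_Suc_eq[of X 3] by auto
  then obtain b c e where abce: "X = {a, b, c, e}" "distinct [a, b, c, e]"
    by (auto simp: card_3_iff)
  have "independent X"
    unfolding abce(1) using X(1,3) abce by (intro independent4) (auto simp: inj_on_def)
  moreover have "X \<subseteq> W"
    using W(2) X(2) mem_ext_point by auto
  moreover obtain B where "W \<subseteq> span B" "card B = dim W"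
    using basis_exists[of W] .
  ultimately have "card X \<le> dim W"
    using independent_span_bound[of B X] by auto
  then show False
    using W(1) \<open>card X = 4\<close> by simp
qed

section \<open>The number of points\<close>

lemma card_theta0: "3 * card (theta0 \<iota> d) = q + 1"
proof -
  have inj: "inj \<iota>"
  proof (rule injI)
    fix a b assume "\<iota> a = \<iota> b"
    then show "a = b"
      using scale_cancel_right[of a 1 b] by (simp add: ext_scale_def)
  qed
  have point: "ext_point \<iota> u - {0} = (\<lambda>c. \<iota> c * u) ` (UNIV - {0})" if "u \<in> U" for u
  proof
    show "ext_point \<iota> u - {0} \<subseteq> (\<lambda>c. \<iota> c * u) ` (UNIV - {0})"
    proof
      fix x assume "x \<in> ext_point \<iota> u - {0}"
      then obtain c where "x = \<iota> c * u" "c \<noteq> 0"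
        by (auto simp: ext_point_iff)
      then show "x \<in> (\<lambda>c. \<iota> c * u) ` (UNIV - {0})"
        by (intro image_eqI[of _ _ c]) simp_all
    qed
  qed (use U_nonzero[OF that] in \<open>auto simp: ext_point_iff\<close>)
  have "card (ext_point \<iota> u - {0}) = 3" if "u \<in> U" for u
    using U_nonzero[OF that] inj card_k
    by (subst point[OF that], subst card_image) (auto simp: inj_on_def card_Diff_singleton)
  then have three: "card (P - {0}) = 3" if "P \<in> theta0 \<iota> d" for P
    using that by (auto simp: theta0_eq)
  have "ext_point \<iota> u - {0} \<subseteq> U" if "u \<in> U" for u
    using that by (subst point) (auto intro: mult_U scalar_U)
  \<comment> \<open>Closed under nonzero scalars, \<open>U\<close> is the union of the points of
    \<open>theta0\<close> without 0. These pieces are disjoint and have 3 elements each.\<close>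
  then have U: "U = (\<Union>P\<in>theta0 \<iota> d. P - {0})"
    using mem_ext_point U_nonzero by (fastforce simp: theta0_eq)
  have same: "ext_point \<iota> x = ext_point \<iota> u" if "u \<in> U" "x \<in> ext_point \<iota> u - {0}" for u x
    using that U_nonzero[OF that(1)] by (auto simp: point ext_point_scale)
  have "(P - {0}) \<inter> (Q - {0}) = {}" if PQ: "P \<in> theta0 \<iota> d" "Q \<in> theta0 \<iota> d" "P \<noteq> Q" for P Q
  proof -
    obtain u v where uv: "u \<in> U" "v \<in> U" "P = ext_point \<iota> u" "Q = ext_point \<iota> v"
      using PQ by (auto simp: theta0_eq)
    then show ?thesis
      using same[of u] same[of v] PQ(3) by blast
  qed
  then have "card U = (\<Sum>P\<in>theta0 \<iota> d. card (P - {0}))"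
    by (subst U, intro card_UN_disjoint) simp_all
  then show ?thesis
    by (simp add: three card_U)
qed

section \<open>Completeness\<close>

lemma complete_four_general_theta0: "complete_four_general (ext_scale \<iota>) (theta0 \<iota> d)"
  unfolding complete_four_general_def
proof (intro conjI four_general_theta0 notI)
  assume "\<exists>S'. theta0 \<iota> d \<subset> S' \<and> four_general (ext_scale \<iota>) S'"
  then obtain S' P where S': "theta0 \<iota> d \<subseteq> S'" "four_general (ext_scale \<iota>) S'"
    and P: "P \<in> S'" "P \<notin> theta0 \<iota> d"
    by auto
  then have "subspace P" "dim P = 1"
    by (auto simp: four_general_def pg_points_def)
  then obtain x where x: "x \<noteq> 0" "P = ext_point \<iota> x"
  proof -
    obtain B where B: "B \<subseteq> P" "independent B" "P \<subseteq> span B" "card B = 1"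
      using basis_exists[of P] \<open>dim P = 1\<close> by metis
    then obtain x where "B = {x}"
      by (auto simp: card_1_singleton_iff)
    with B have "x \<noteq> 0" "P \<subseteq> span {x}" "{x} \<subseteq> P"
      by auto
    then show thesis
      using that \<open>subspace P\<close> span_minimal[of "{x}" P] unfolding ext_point_def by blast
  qed
  \<comment> \<open>The alternative \<open>x \<in> U\<close> is excluded, since \<open>P\<close>
    would then belong to \<open>theta0\<close>.\<close>
  then obtain a b c where abc: "a \<in> U" "b \<in> U" "c \<in> U" "x = a + b + c"
    using three_term_representation[OF x(1)] P(2) by (auto simp: theta0_eq)
  \<comment> \<open>The points of \<open>a\<close>, \<open>b\<close>, \<open>c\<close> may coincide,
    so they are completed to a set \<open>Q\<close> of exactly three points of
    \<open>theta0\<close>, whose span is a plane.\<close>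
  let ?A = "ext_point \<iota> ` {a, b, c}"
  have "card ?A \<le> 3"
    by (rule order_trans[OF card_image_le]) (auto simp: card_insert_if)
  moreover have "3 \<le> card (theta0 \<iota> d)"
  proof -
    \<comment> \<open>Here \<open>d \<ge> 1\<close> enters: from \<open>q \<ge> 8\<close> there are
      at least three points to choose from.\<close>
    have "(2::nat) ^ 3 \<le> q"
      unfolding q_def using d_pos by (intro power_increasing) auto
    then show ?thesis
      using card_theta0 by simp
  qed
  moreover have "?A \<subseteq> theta0 \<iota> d"
    using abc by (auto simp: theta0_eq)
  ultimately obtain Q where Q: "?A \<subseteq> Q" "Q \<subseteq> theta0 \<iota> d" "card Q = 3"
    using exists_subset_between[of ?A 3 "theta0 \<iota> d"] by (auto simp: theta0_eq)
  obtain X where X: "X \<subseteq> U" "Q = ext_point \<iota> ` X" "inj_on (ext_point \<iota>) X"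
    using Q(2) subset_image_inj[of Q "ext_point \<iota>" U] by (auto simp: theta0_eq)
  have "card X = 3"
    using Q(3) X by (simp add: card_image)
  then obtain u v w where uvw: "X = {u, v, w}" "distinct [u, v, w]"
    by (auto simp: card_3_iff)
  have "independent X"
    unfolding uvw(1) using X(1,3) uvw by (intro independent3) (auto simp: inj_on_def)
  then have plane: "span X \<in> pg_planes (ext_scale \<iota>)"
    using \<open>card X = 3\<close> by (simp add: pg_planes_def subspace_span dim_eq_card_independent)
  have Q_le: "A \<subseteq> span X" if A: "A \<in> Q" for A
  proof -
    obtain y where "y \<in> X" "A = span {y}"
      using A X(2) by (auto simp: ext_point_def)
    then show ?thesis
      by (simp add: span_mono)
  qed
  then have "a \<in> span X" "b \<in> span X" "c \<in> span X"
    using Q(1) mem_ext_point by auto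
  then have "x \<in> span X"
    unfolding abc(4) by (intro span_add)
  then have "P \<subseteq> span X"
    unfolding x(2) ext_point_def by (simp add: span_minimal subspace_span)
  then have "\<forall>A\<in>insert P Q. A \<subseteq> span X"
    using Q_le by auto
  moreover have "insert P Q \<subseteq> S'"
    using P Q S' by auto
  moreover have "card (insert P Q) = 4"
  proof -
    have "finite Q" "P \<notin> Q"
      using Q P card_ge_0_finite[of Q] by auto
    then show ?thesis
      using Q(3) by simp
  qed
  \<comment> \<open>\<open>P\<close> and the three points of \<open>Q\<close> are four points of
    \<open>S'\<close> on the plane \<open>span X\<close>.\<close>
  ultimately show False
    using S'(2) plane unfolding four_general_def by blast
qed

end

theorem theorem4p3:
  fixes d :: nat and \<iota> :: "'k::{field,finite} \<Rightarrow> 'l::{field,finite}"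
  assumes "d \<ge> 1"
    and "CARD('k) = 4"
    and "CARD('l) = 4 ^ (2 * d + 1)"
    and "field_embedding \<iota>"
  shows "complete_four_general (ext_scale \<iota>) (theta0 \<iota> d) \<and>
         real (card (theta0 \<iota> d)) = (2 ^ (2 * d + 1) + 1) / 3"
proof -
  interpret quadratic_even_extension d \<iota>
    using assms by unfold_locales
  have "real (3 * card (theta0 \<iota> d)) = real (q + 1)"
    by (simp only: card_theta0)
  then have "real (card (theta0 \<iota> d)) = (2 ^ (2 * d + 1) + 1) / 3"
    by (simp add: q_def)
  then show ?thesis
    using complete_four_general_theta0 by blast
qed

end
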